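(* Let $B=\{120,210\}$, and let $A(x,v)$ and $B(x,v,u)$ be the generating functions defined in the context. The generating function $\sum_{n\geq 0}|I_n(120,210)|\,x^{n+1}$ is equal to $A(x,0)$, and it satisfies $$A(x,0)=\frac{x}{1-x}+x\,B(x,x,1).$$
   Context: For $n\ge 0$, $I_n$ denotes the set of inversion sequences $e=e_0e_1\cdots e_n$, i.e. integer sequences with $0\le e_i\le i$ for each $0\le i\le n$. An inversion sequence contains a pattern $\tau$ if it has a (not necessarily consecutive) subsequence order isomorphic to $\tau$ (including equalities); otherwise it avoids $\tau$. $I_n(\tau_1,\dots,\tau_m)$ (also written $I_n(B)$ for $B=\{\tau_1,\dots,\tau_m\}$) is the set of $e\in I_n$ avoiding all $\tau_i$. $\mathcal T(B)$ is the rooted plane tree with root $0$ whose level-$n$ nodes are the elements of $I_n(B)$ (root at level 0), where the parent of $e_0\cdots e_n$ is $e_0\cdots e_{n-1}$ and siblings are ordered left to right by increasing last letter. For a node $e$, $\mathcal T(B;e)$ is the subtree consisting of $e$ and its descendants. The generating function for the number of nodes in $\mathcal T(B;e)$ is the power series in which a node at distance $\ell\ge 0$ below the root $e$ contributes $x^{\ell+1}$. Here $0^m$ is the word of $m$ zeros and $0^mj$ is $0^m$ followed by the letter $j$. Let $A_m(x)$ (for $m\ge1$) and $B_{m,j}(x)$ (for $1\le j\le m$) be the generating functions for the number of nodes in $\mathcal T(B;0^m)$ and $\mathcal T(B;0^mj)$ respectively, and set $$A(x,v)=\sum_{m\ge1}A_m(x)v^{m-1},\qquad B(x,v,u)=\sum_{m\ge1}\sum_{j=1}^m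 B_{m,j}(x)\,v^{m-1}u^{m-j}.$$ *)

theory Defs
  imports
    Complex_Main
    "HOL-Library.Sublist"
    "HOL-Computational_Algebra.Polynomial"
    "HOL-Computational_Algebra.Formal_Power_Series"
begin

section \<open>Inversion sequences and pattern avoidance\<close>

text \<open>A word \<open>e\<^sub>0 e\<^sub>1 \<dots> e\<^sub>n\<close> is a list of length \<open>n + 1\<close>.\<close>

definition inversion_seqs :: "nat \<Rightarrow> nat list set" where
  "inversion_seqs n = {e. length e = n + 1 \<and> (\<forall>i\<le>n. e ! i \<le> i)}"

definition order_isomorphic :: "nat list \<Rightarrow> nat list \<Rightarrow> bool" where
  "order_isomorphic s t \<longleftrightarrow> length s = length t \<and>
     (\<forall>i<length s. \<forall>j<length s.
        (s ! i < s ! j \<longleftrightarrow> t ! i < t ! j) \<and> (s ! i = s ! j \<longleftrightarrow> t ! i = t ! j))"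

definition contains_pattern :: "nat list \<Rightarrow> nat list \<Rightarrow> bool" where
  "contains_pattern e \<tau> \<longleftrightarrow> (\<exists>s. subseq s e \<and> order_isomorphic s \<tau>)"

definition avoiding_seqs :: "nat list set \<Rightarrow> nat \<Rightarrow> nat list set" where
  "avoiding_seqs B n = {e \<in> inversion_seqs n. \<forall>\<tau>\<in>B. \<not> contains_pattern e \<tau>}"

section \<open>Rooted plane trees\<close>

record 'a plane_tree =
  tree_nodes :: "'a set"
  tree_root :: 'a
  child_rel :: "('a \<times> 'a) set"      \<comment> \<open>\<open>(e, f)\<close>: \<open>e\<close> is the parent of \<open>f\<close>\<close>
  left_rel :: "('a \<times> 'a) set"       \<comment> \<open>\<open>(e, f)\<close>: \<open>e\<close> is a sibling of \<open>f\<close> to the left of \<open>f\<close>\<close>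

definition subtree :: "'a plane_tree \<Rightarrow> 'a \<Rightarrow> 'a plane_tree" where
  "subtree T e =
     (let D = {f \<in> tree_nodes T. (e, f) \<in> (child_rel T)\<^sup>*} in
      \<lparr>tree_nodes = D,
       tree_root = e,
       child_rel = child_rel T \<inter> D \<times> D,
       left_rel = left_rel T \<inter> (D - {e}) \<times> (D - {e})\<rparr>)"

definition nodes_at_distance :: "'a plane_tree \<Rightarrow> nat \<Rightarrow> 'a set" where
  "nodes_at_distance T l = {f \<in> tree_nodes T. (tree_root T, f) \<in> child_rel T ^^ l}"

text \<open>A node at distance \<open>l\<close> below the root contributes \<open>x ^ (l + 1)\<close>.\<close>

definition node_gf :: "'a plane_tree \<Rightarrow> rat fps" where
  "node_gf T = fps_X * Abs_fps (\<lambda>l. of_nat (card (nodes_at_distance T l)))"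

section \<open>The generating tree of a set of patterns\<close>

definition gen_tree :: "nat list set \<Rightarrow> nat list plane_tree" where
  "gen_tree B =
     (let V = (\<Union>n. avoiding_seqs B n) in
      \<lparr>tree_nodes = V,
       tree_root = [0],
       child_rel = {(e, f). e \<in> V \<and> f \<in> V \<and> e = butlast f},
       left_rel = {(e, f). e \<in> V - {[0]} \<and> f \<in> V - {[0]} \<and> butlast e = butlast f \<and> last e < last f}\<rparr>)"

definition A_gf :: "nat list set \<Rightarrow> nat \<Rightarrow> rat fps" where
  "A_gf B m = node_gf (subtree (gen_tree B) (replicate m 0))"

definition B_gf :: "nat list set \<Rightarrow> nat \<Rightarrow> nat \<Rightarrow> rat fps" where
  "B_gf B m j = node_gf (subtree (gen_tree B) (replicate m 0 @ [j]))"

section \<open>The multivariate generating functions\<close>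

text \<open>
  The outer power series variable is \<open>v\<close>, the innermost one is \<open>x\<close>.  The coefficient of
  \<open>v ^ (m - 1)\<close> in \<open>B(x, v, u)\<close> is a polynomial in \<open>u\<close>, so that \<open>u\<close> may be evaluated at \<open>1\<close>.
  The coefficient index is \<open>k = m - 1\<close>.
\<close>

definition A_series :: "nat list set \<Rightarrow> rat fps fps" where
  "A_series B = Abs_fps (\<lambda>k. A_gf B (k + 1))"

definition B_series :: "nat list set \<Rightarrow> rat fps poly fps" where
  "B_series B = Abs_fps (\<lambda>k. \<Sum>j=1..k+1. monom (B_gf B (k + 1) j) (k + 1 - j))"

definition eval_u :: "rat fps poly fps \<Rightarrow> rat fps \<Rightarrow> rat fps fps" where
  "eval_u F c = Abs_fps (\<lambda>k. poly (fps_nth F k) c)"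

text \<open>
  Substitution of a power series in \<open>x\<close> for \<open>v\<close>; the infinite sum is taken in the \<open>x\<close>-adic
  topology and converges whenever the constant coefficient of \<open>y\<close> vanishes.
\<close>

definition eval_v :: "rat fps fps \<Rightarrow> rat fps \<Rightarrow> rat fps" where
  "eval_v F y = (\<Sum>k. fps_nth F k * y ^ k)"

lemma eval_v_sums:
  assumes y: "fps_nth y 0 = 0"
  shows "(\<lambda>k. fps_nth F k * y ^ k) sums
           Abs_fps (\<lambda>n. \<Sum>k\<le>n. fps_nth (fps_nth F k * y ^ k) n)"
  unfolding sums_def
proof (rule tendsto_fpsI)
  fix n
  have zero: "fps_nth (fps_nth F k * y ^ k) n = 0" if "k > n" for k
    unfolding fps_mult_nth
  proof (rule sum.neutral, rule ballI)
    fix i assume "i \<in> {0..n}"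
    then have "n - i < k" using that by simp
    then have "fps_nth (y ^ k) (n - i) = 0"
      using y by (simp add: startsby_zero_power_prefix)
    then show "fps_nth (fps_nth F k) i * fps_nth (y ^ k) (n - i) = 0" by simp
  qed
  show "\<forall>\<^sub>F N in sequentially.
      fps_nth (\<Sum>k<N. fps_nth F k * y ^ k) n =
      fps_nth (Abs_fps (\<lambda>n. \<Sum>k\<le>n. fps_nth (fps_nth F k * y ^ k) n)) n"
  proof (rule eventually_sequentiallyI[of "Suc n"])
    fix N assume "Suc n \<le> N"
    then have "(\<Sum>k<N. fps_nth (fps_nth F k * y ^ k) n) = (\<Sum>k\<le>n. fps_nth (fps_nth F k * y ^ k) n)"
      by (intro sum.mono_neutral_right) (auto simp: zero)
    then show "fps_nth (\<Sum>k<N. fps_nth F k * y ^ k) n =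
        fps_nth (Abs_fps (\<lambda>n. \<Sum>k\<le>n. fps_nth (fps_nth F k * y ^ k) n)) n"
      by (simp add: fps_sum_nth)
  qed
qed

lemma fps_nth_eval_v:
  assumes "fps_nth y 0 = 0"
  shows "fps_nth (eval_v F y) n = (\<Sum>k\<le>n. fps_nth (fps_nth F k * y ^ k) n)"
  by (simp add: eval_v_def flip: sums_unique[OF eval_v_sums[OF assms, of F]])

end

theory Submission
  imports Defs
begin

text \<open>
  A node of the tree is either an all-zero word, or it has a first nonzero letter \<open>j\<close>, preceded
  by \<open>m\<close> zeros, and then it lies in the subtree rooted at \<open>0\<^sup>m j\<close> for exactly this
  pair \<open>(m, j)\<close>; for inversion sequences \<open>1 \<le> j \<le> m\<close> holds automatically.  The all-zero words
  avoid both patterns, so there is exactly one of them on each level, and together they contribute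
  \<open>x / (1 - x)\<close>.  The root \<open>0\<^sup>m j\<close> lies on level \<open>m\<close>, so its subtree contributes
  \<open>x\<^sup>m B\<^sub>m\<^sub>,\<^sub>j(x)\<close>, and the sum of these series over all \<open>m\<close> and \<open>j\<close> is \<open>x B(x, x, 1)\<close>.

  Since avoidance is inherited by prefixes, the descendants of a node are precisely the nodes that
  have it as a prefix (lemma \<open>nodes_at_distance_subtree\<close>).  The decomposition is carried out on
  coefficients in \<open>card_avoiding_seqs\<close>.  The patterns matter only through the fact that
  all-zero words avoid them.
\<close>

section \<open>Descendants in the generating tree\<close>

lemma finite_avoiding_seqs: "finite (avoiding_seqs B n)"
proof (rule finite_subset)
  show "avoiding_seqs B n \<subseteq> {e. set e \<subseteq> {..n} \<and> length e = n + 1}"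
    by (force simp: avoiding_seqs_def inversion_seqs_def in_set_conv_nth less_Suc_eq_le)
qed (simp add: finite_lists_length_eq)

lemma length_avoiding_seqs: "e \<in> avoiding_seqs B n \<Longrightarrow> length e = Suc n"
  by (simp add: avoiding_seqs_def inversion_seqs_def)

lemma contains_pattern_append: "contains_pattern e \<tau> \<Longrightarrow> contains_pattern (e @ e') \<tau>"
  unfolding contains_pattern_def by (blast intro: list_emb_append2)

lemma avoiding_seqs_butlast:
  assumes "e @ [a] \<in> avoiding_seqs B (Suc n)"
  shows "e \<in> avoiding_seqs B n"
proof -
  from assms have len: "length e = Suc n" and le: "\<forall>i\<le>Suc n. (e @ [a]) ! i \<le> i"
    and av: "\<forall>\<tau>\<in>B. \<not> contains_pattern (e @ [a]) \<tau>"
    by (auto simp: avoiding_seqs_def inversion_seqs_def)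
  have "e ! i \<le> i" if "i \<le> n" for i
    using le[rule_format, of i] that len by (simp add: nth_append)
  then show ?thesis
    using len av contains_pattern_append by (auto simp: avoiding_seqs_def inversion_seqs_def)
qed

text \<open>
  A word of length \<open>d + 1\<close> lies on level \<open>d\<close>.  It need not itself be a node:
  if it contains a pattern, then so do all its extensions, and both sides are empty.
\<close>

lemma nodes_at_distance_subtree:
  assumes e: "length e = Suc d"
  shows "nodes_at_distance (subtree (gen_tree B) e) l = {f \<in> avoiding_seqs B (d + l). prefix e f}"
proof -
  define V where "V = (\<Union>n. avoiding_seqs B n)"
  define R where "R = {(e, f). e \<in> V \<and> f \<in> V \<and> e = butlast f}"
  define D where "D = {f \<in> V. (e, f) \<in> R\<^sup>*}"
  have V_iff: "f \<in> V \<longleftrightarrow> f \<in> avoiding_seqs B n" if "length f = Suc n" for f n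
    using that length_avoiding_seqs by (fastforce simp: V_def)
  have "f \<in> D \<and> (e, f) \<in> (R \<inter> D \<times> D) ^^ l \<longleftrightarrow> f \<in> avoiding_seqs B (d + l) \<and> prefix e f" for f
  proof (induction l arbitrary: f)
    case 0
    have "f = e" if "f \<in> avoiding_seqs B d" "prefix e f"
      using that e by (auto simp: prefix_def dest: length_avoiding_seqs)
    moreover have "e \<in> D \<longleftrightarrow> e \<in> avoiding_seqs B d"
      using V_iff[OF e] by (simp add: D_def)
    ultimately show ?case by auto
  next
    case (Suc l)
    show ?case
    proof
      assume "f \<in> D \<and> (e, f) \<in> (R \<inter> D \<times> D) ^^ Suc l"
      then obtain g where g: "(e, g) \<in> (R \<inter> D \<times> D) ^^ l" "g \<in> D"
        and gf: "(g, f) \<in> R" and f: "f \<in> V" by (auto simp: D_def)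
      from g Suc.IH have g': "g \<in> avoiding_seqs B (d + l)" "prefix e g" by blast+
      have len: "length g = Suc (d + l)" using g'(1) by (rule length_avoiding_seqs)
      have "g = butlast f" using gf by (simp add: R_def)
      then have "f = g @ [last f]" using len by (cases f rule: rev_cases) auto
      then obtain a where "f = g @ [a]" by blast
      then show "f \<in> avoiding_seqs B (d + Suc l) \<and> prefix e f"
        using f len g'(2) V_iff[of f "d + Suc l"] by simp
    next
      assume f: "f \<in> avoiding_seqs B (d + Suc l) \<and> prefix e f"
      then have len: "length f = Suc (Suc (d + l))" by (auto dest: length_avoiding_seqs)
      then obtain g a where fg: "f = g @ [a]" by (cases f rule: rev_cases) auto
      have "e \<noteq> g @ [a]" using e len fg by auto
      then have "prefix e g" using f fg by auto
      moreover have "g \<in> avoiding_seqs B (d + l)" using f fg avoiding_seqs_butlast by auto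
      ultimately have g: "g \<in> D" "(e, g) \<in> (R \<inter> D \<times> D) ^^ l" using Suc.IH by blast+
      have "(g, f) \<in> R" using f g(1) fg by (auto simp: R_def D_def V_def)
      moreover from this have "f \<in> D"
        using g(1) by (auto simp: D_def R_def intro: rtrancl_into_rtrancl)
      ultimately show "f \<in> D \<and> (e, f) \<in> (R \<inter> D \<times> D) ^^ Suc l"
        using g by auto
    qed
  qed
  then show ?thesis
    by (auto simp: nodes_at_distance_def subtree_def gen_tree_def Let_def V_def R_def D_def)
qed

section \<open>Decomposition at the first nonzero letter\<close>

lemma contains_pattern_replicate:
  assumes "contains_pattern (replicate n a) \<tau>" "x \<in> set \<tau>" "y \<in> set \<tau>"
  shows "x = y"
proof -
  from assms(1) obtain s where s: "subseq s (replicate n a)" "order_isomorphic s \<tau>"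
    by (auto simp: contains_pattern_def)
  have const: "s ! i = a" if "i < length s" for i
  proof -
    have "s ! i \<in> set s" using that by (rule nth_mem)
    then obtain b where "b \<in> set (replicate n a)" "s ! i = b"
      using s(1) by (blast elim: list_emb_set)
    then show ?thesis by simp
  qed
  have len: "length s = length \<tau>" using s(2) by (simp add: order_isomorphic_def)
  obtain i j where "i < length \<tau>" "\<tau> ! i = x" "j < length \<tau>" "\<tau> ! j = y"
    using assms(2,3) by (auto simp: in_set_conv_nth)
  moreover have "s ! i = s ! j \<longleftrightarrow> \<tau> ! i = \<tau> ! j" if "i < length \<tau>" "j < length \<tau>" for i j
    using s(2) that len by (simp add: order_isomorphic_def)
  ultimately show ?thesis using const len by metis
qed

lemma replicate_0_avoiding:
  assumes "\<forall>\<tau>\<in>B. \<exists>a\<in>set \<tau>. \<exists>b\<in>set \<tau>. a \<noteq> b"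
  shows "replicate (Suc n) 0 \<in> avoiding_seqs B n"
  using assms contains_pattern_replicate[of "Suc n" 0]
  by (auto simp: avoiding_seqs_def inversion_seqs_def nth_Cons split: nat.splits simp del: replicate_Suc)

text \<open>
  A prefix \<open>0\<^sup>m j\<close> with \<open>j \<noteq> 0\<close> can be recovered from the word, so the subtrees
  rooted at different words of this shape are disjoint.
\<close>

lemma takeWhile_zeros:
  assumes "prefix (replicate m 0 @ [j]) f" "j \<noteq> (0::nat)"
  shows "takeWhile (\<lambda>a. a = 0) f = replicate m 0" "f ! m = j"
  using assms by (auto simp: prefix_def nth_append takeWhile_append)

lemma first_nonzero_letter:
  assumes "f \<in> inversion_seqs n"
  shows "f = replicate (Suc n) 0 \<or>
    (\<exists>k<n. \<exists>j\<in>{1..k + 1}. prefix (replicate (k + 1) 0 @ [j]) f)"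
proof -
  define z where "z = takeWhile (\<lambda>a. a = 0) f"
  define r where "r = dropWhile (\<lambda>a. a = 0) f"
  have len: "length f = Suc n" and le: "f ! i \<le> i" if "i \<le> n" for i
    using assms that by (auto simp: inversion_seqs_def)
  have f: "f = z @ r" by (simp add: z_def r_def)
  have z: "z = replicate (length z) 0"
    unfolding z_def by (rule replicate_eqI) (use set_takeWhileD in fastforce)+
  show ?thesis
  proof (cases r)
    case Nil
    then show ?thesis using f z len[of 0] by simp
  next
    case (Cons j r')
    have "j \<noteq> 0" using Cons hd_dropWhile[of "\<lambda>a. a = 0" f] by (auto simp: r_def)
    moreover have "length z \<le> n" using f len[of 0] Cons by simp
    moreover have "f ! length z = j" using f Cons by simp
    \<comment> \<open>The inversion bound at the first nonzero letter gives \<open>j \<le> m\<close>, so \<open>m > 0\<close>.\<close>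
    ultimately have j: "1 \<le> j" "j \<le> length z" using le[of "length z"] by auto
    then obtain k where k: "length z = k + 1" by (cases "length z") auto
    have "f = (replicate (k + 1) 0 @ [j]) @ r'" using f z k Cons by simp
    then have "prefix (replicate (k + 1) 0 @ [j]) f" by (rule prefixI)
    then show ?thesis using j k \<open>length z \<le> n\<close> by force
  qed
qed

text \<open>
  Here \<open>k = m - 1\<close>, where \<open>m \<ge> 1\<close> is the number of leading zeros; the leading zeros and
  the letter \<open>j\<close> must fit into \<open>n + 1\<close> letters, hence \<open>k < n\<close>.
\<close>

lemma card_avoiding_seqs:
  assumes "\<forall>\<tau>\<in>B. \<exists>a\<in>set \<tau>. \<exists>b\<in>set \<tau>. a \<noteq> b"
  shows "card (avoiding_seqs B n) = 1 + (\<Sum>k<n. \<Sum>j=1..k + 1.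
    card {f \<in> avoiding_seqs B n. prefix (replicate (k + 1) 0 @ [j]) f})"
proof -
  define S where
    "S = (\<lambda>(k, j). {f \<in> avoiding_seqs B n. prefix (replicate (k + 1) 0 @ [j]) f})"
  define I where "I = (SIGMA k:{..<n}. {1..k + 1})"
  have fin: "finite (S p)" for p
    using finite_avoiding_seqs[of B n] by (auto simp: S_def split: prod.splits)
  have split: "avoiding_seqs B n = insert (replicate (Suc n) 0) (\<Union>p\<in>I. S p)"
  proof
    show "avoiding_seqs B n \<subseteq> insert (replicate (Suc n) 0) (\<Union>p\<in>I. S p)"
    proof
      fix f assume f: "f \<in> avoiding_seqs B n"
      then have "f \<in> inversion_seqs n" by (simp add: avoiding_seqs_def)
      from first_nonzero_letter[OF this] f
      show "f \<in> insert (replicate (Suc n) 0) (\<Union>p\<in>I. S p)"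
        by (fastforce simp: S_def I_def)
    qed
    show "insert (replicate (Suc n) 0) (\<Union>p\<in>I. S p) \<subseteq> avoiding_seqs B n"
      using replicate_0_avoiding[OF assms, of n] by (auto simp: S_def)
  qed
  have notin: "replicate (Suc n) 0 \<notin> (\<Union>p\<in>I. S p)"
  proof
    assume "replicate (Suc n) 0 \<in> (\<Union>p\<in>I. S p)"
    then obtain k j where "j \<ge> 1" "prefix (replicate (k + 1) 0 @ [j]) (replicate (Suc n) (0::nat))"
      by (auto simp: S_def I_def)
    then have "j \<in> set (replicate (Suc n) 0)" using set_mono_prefix by fastforce
    with \<open>j \<ge> 1\<close> show False by simp
  qed
  have disj: "S p \<inter> S q = {}" if pq: "p \<in> I" "q \<in> I" "p \<noteq> q" for p q
  proof (rule ccontr)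
    assume "S p \<inter> S q \<noteq> {}"
    then obtain f where f: "f \<in> S p" "f \<in> S q" by blast
    obtain k j k' j' where p: "p = (k, j)" and q: "q = (k', j')" by (metis surj_pair)
    have pre: "prefix (replicate (k + 1) 0 @ [j]) f" "prefix (replicate (k' + 1) 0 @ [j']) f"
      and nz: "j \<noteq> 0" "j' \<noteq> 0"
      using f pq p q by (auto simp: S_def I_def)
    have "replicate (k + 1) (0::nat) = replicate (k' + 1) 0"
      using takeWhile_zeros(1)[OF pre(1) nz(1)] takeWhile_zeros(1)[OF pre(2) nz(2)] by simp
    then have "k = k'" by (metis add_right_cancel length_replicate)
    moreover from this have "j = j'"
      using takeWhile_zeros(2)[OF pre(1) nz(1)] takeWhile_zeros(2)[OF pre(2) nz(2)] by simp
    ultimately show False using pq p q by simp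
  qed
  have "card (avoiding_seqs B n) = 1 + card (\<Union>p\<in>I. S p)"
    unfolding split using notin fin by (subst card_insert_disjoint) (auto simp: I_def)
  also have "card (\<Union>p\<in>I. S p) = (\<Sum>p\<in>I. card (S p))"
    using fin disj by (intro card_UN_disjoint) (auto simp: I_def)
  also have "\<dots> = (\<Sum>k<n. \<Sum>j=1..k + 1. card (S (k, j)))"
    unfolding I_def by (subst sum.Sigma) auto
  finally show ?thesis by (simp add: S_def)
qed

section \<open>Generating functions\<close>

lemma eval_v_0: "eval_v F 0 = fps_nth F 0"
proof (rule fps_ext)
  fix n
  have "fps_nth (eval_v F 0) n = (\<Sum>k\<le>n. fps_nth (fps_nth F k * 0 ^ k) n)"
    by (rule fps_nth_eval_v) simp
  also have "\<dots> = (\<Sum>k\<in>{0}. fps_nth (fps_nth F k * 0 ^ k) n)"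
    by (rule sum.mono_neutral_right) (auto simp: power_0_left)
  finally show "fps_nth (eval_v F 0) n = fps_nth (fps_nth F 0) n" by simp
qed

lemma A_gf_1: "A_gf B 1 = fps_X * Abs_fps (\<lambda>n. of_nat (card (avoiding_seqs B n)))"
proof -
  have "prefix [0] f" if "f \<in> avoiding_seqs B n" for f n
    using that by (cases f) (auto simp: avoiding_seqs_def inversion_seqs_def)
  then have "{f \<in> avoiding_seqs B n. prefix [0] f} = avoiding_seqs B n" for n by blast
  then show ?thesis
    by (simp add: A_gf_def node_gf_def nodes_at_distance_subtree[of _ 0])
qed

text \<open>
  The words on level \<open>n\<close> that extend \<open>0\<^sup>k\<^sup>+\<^sup>1 j\<close>, a word on level \<open>k + 1\<close>, are at
  distance \<open>n - k - 1\<close> below it, and so are counted by the coefficient of \<open>x\<^sup>n\<^sup>-\<^sup>k\<close>.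
\<close>

lemma B_gf_nth:
  assumes "k \<le> n"
  shows "fps_nth (B_gf B (k + 1) j) (n - k) = (if k = n then 0
    else of_nat (card {f \<in> avoiding_seqs B n. prefix (replicate (k + 1) 0 @ [j]) f}))"
  using assms nodes_at_distance_subtree[of "replicate (k + 1) 0 @ [j]" "k + 1" B "n - k - 1"]
  by (simp add: B_gf_def node_gf_def)

lemma eval_B_series_nth:
  "fps_nth (eval_v (eval_u (B_series B) 1) fps_X) n =
    of_nat (\<Sum>k<n. \<Sum>j=1..k + 1.
      card {f \<in> avoiding_seqs B n. prefix (replicate (k + 1) 0 @ [j]) f})"
proof -
  let ?c = "\<lambda>k j. card {f \<in> avoiding_seqs B n. prefix (replicate (k + 1) 0 @ [j]) f}"
  have "fps_nth (eval_v (eval_u (B_series B) 1) fps_X) n =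
      (\<Sum>k\<le>n. \<Sum>j=1..k + 1. fps_nth (B_gf B (k + 1) j) (n - k))"
    by (subst fps_nth_eval_v)
      (auto simp: eval_u_def B_series_def poly_sum poly_monom fps_X_power_mult_right_nth fps_sum_nth
        intro!: sum.cong)
  also have "\<dots> = (\<Sum>k\<le>n. \<Sum>j=1..k + 1. if k = n then 0 else of_nat (?c k j))"
    by (intro sum.cong refl B_gf_nth) simp
  also have "\<dots> = (\<Sum>k<n. \<Sum>j=1..k + 1. of_nat (?c k j))"
    by (simp add: lessThan_Suc_atMost[symmetric])
  finally show ?thesis by simp
qed

theorem theorem4p12:
  fixes B :: "nat list set"
  assumes "B = {[1, 2, 0], [2, 1, 0]}"
  shows "fps_X * Abs_fps (\<lambda>n. of_nat (card (avoiding_seqs B n))) = eval_v (A_series B) 0 \<and>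
         eval_v (A_series B) 0
           = fps_X / (1 - fps_X) + fps_X * eval_v (eval_u (B_series B) 1) fps_X"
proof -
  have nonconst: "\<forall>\<tau>\<in>B. \<exists>a\<in>set \<tau>. \<exists>b\<in>set \<tau>. a \<noteq> b"
    using assms by auto
  have A: "eval_v (A_series B) 0 = fps_X * Abs_fps (\<lambda>n. of_nat (card (avoiding_seqs B n)))"
    using A_gf_1[of B] by (simp add: eval_v_0 A_series_def)
  have geo: "fps_X / (1 - fps_X) = fps_X * Abs_fps (\<lambda>n. 1 :: rat)"
    by (simp add: fps_divide_unit fps_inverse_one_minus_fps_X)
  have "Abs_fps (\<lambda>n. of_nat (card (avoiding_seqs B n))) =
      Abs_fps (\<lambda>n. 1) + eval_v (eval_u (B_series B) 1) fps_X"
  proof (rule fps_ext)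
    fix n
    show "fps_nth (Abs_fps (\<lambda>n. of_nat (card (avoiding_seqs B n)))) n =
      fps_nth (Abs_fps (\<lambda>n. 1) + eval_v (eval_u (B_series B) 1) fps_X) n"
      unfolding fps_add_nth eval_B_series_nth by (simp add: card_avoiding_seqs[OF nonconst])
  qed
  then show ?thesis
    unfolding A geo by (simp add: distrib_left)
qed

end
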